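(* Let $n,m\ge 1$ be integers, $s=n+m-1$, $N=\binom{s+2}{2}=\binom{n+m+1}{2}$, and let $\mathbf{z}_0\in\mathbb{R}^s$ be a vector with no zero entries. Let $\mathbf{u}_2=\mathbf{u}_2(\mathbf{z})$ be the vector of all $N$ monomials of degree at most $2$ in $\mathbf{z}=(z_1,\dots,z_s)$, with first entry $1$, and let $(\mathbf{u}_2)_0:=\mathbf{u}_2(\mathbf{z}_0)\in\mathbb{R}^N$. Then there exist real symmetric positive semidefinite $N\times N$ matrices $Q$, $\overline{E}$, $\Gamma$, each of rank exactly $N-1$, such that, as polynomials in $\mathbf{z}$, $$\mathbf{u}_2^{T} Q\,\mathbf{u}_2-(\mathbf{u}_2)_0^{T} Q\,(\mathbf{u}_2)_0=\left(\mathbf{u}_2-(\mathbf{u}_2)_0\right)^{T}\overline{E}\left(\mathbf{u}_2-(\mathbf{u}_2)_0\right)=\mathbf{u}_2^{T}\Gamma\,\mathbf{u}_2 .$$ As a result, $\mathbf{u}_2^{T} Q\,\mathbf{u}_2-(\mathbf{u}_2)_0^{T} Q\,(\mathbf{u}_2)_0$ is a sum-of-squares polynomial. In particular, $Q$ can be chosen with the arrowhead sparsity pattern.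
   Context: Setting (rank-1 matrix completion): $\mathbf{x}_0\in\mathbb{R}^n$ and $\mathbf{y}_0\in\mathbb{R}^m$ are the true factors of a rank-1 matrix $X_0=\mathbf{x}_0\mathbf{y}_0^T$, normalized so that $(\mathbf{x}_0)_1=1$; the variable vector is $\mathbf{z}=(x_2,\dots,x_n,y_1,\dots,y_m)\in\mathbb{R}^s$ and $\mathbf{z}_0=((\mathbf{x}_0)_2,\dots,(\mathbf{x}_0)_n,(\mathbf{y}_0)_1,\dots,(\mathbf{y}_0)_m)$. The monomials in $\mathbf{u}_2$ are listed in a fixed order with the constant monomial $1$ first. A symmetric $N\times N$ matrix has the arrowhead sparsity pattern if its only possibly nonzero entries are those in the first row, the first column and on the diagonal. A polynomial is a sum of squares if it equals $\sum_{j=1}^{r} q_j(\mathbf{z})^2$ for finitely many real polynomials $q_j$. *)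

theory Defs
  imports
    "HOL-Library.Poly_Mapping"
    "Jordan_Normal_Form.Matrix"
    "Jordan_Normal_Form.DL_Rank"
begin

text \<open>
  Real multivariate polynomials are finitely supported maps from exponent vectors to
  coefficients, so equality of polynomials is equality of all coefficients and
  multiplication is the convolution product of \<^theory>\<open>HOL-Library.Poly_Mapping\<close>.
  Variables are indexed from 0: the variable with index \<open>i\<close> is \<open>z\<close> with index \<open>i + 1\<close> in
  one-based notation.
\<close>

type_synonym mpoly = "(nat \<Rightarrow>\<^sub>0 nat) \<Rightarrow>\<^sub>0 real"

definition polys_in :: "nat \<Rightarrow> mpoly set" where
  "polys_in s = {p. \<forall>a \<in> Poly_Mapping.keys p. Poly_Mapping.keys a \<subseteq> {..<s}}"

definition pconst :: "real \<Rightarrow> mpoly" where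
  "pconst c = Poly_Mapping.single 0 c"

definition peval :: "real vec \<Rightarrow> mpoly \<Rightarrow> real" where
  "peval z p = (\<Sum>a \<in> Poly_Mapping.keys p.
     Poly_Mapping.lookup p a *
       (\<Prod>i \<in> Poly_Mapping.keys a. (z $ i) ^ Poly_Mapping.lookup a i))"

definition monomials :: "nat \<Rightarrow> nat \<Rightarrow> mpoly set" where
  "monomials s d = {Poly_Mapping.single a 1 | a.
     Poly_Mapping.keys a \<subseteq> {..<s} \<and>
     (\<Sum>i \<in> Poly_Mapping.keys a. Poly_Mapping.lookup a i) \<le> d}"

text \<open>The order in which the nonconstant monomials are listed is left arbitrary.\<close>

definition monomial_vec :: "nat \<Rightarrow> nat \<Rightarrow> mpoly vec \<Rightarrow> bool" where
  "monomial_vec s d u \<longleftrightarrow>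
     bij_betw (\<lambda>i. u $ i) {..<dim_vec u} (monomials s d) \<and> u $ 0 = 1"

definition sum_of_squares :: "nat \<Rightarrow> mpoly \<Rightarrow> bool" where
  "sum_of_squares s p \<longleftrightarrow>
     (\<exists>qs. set qs \<subseteq> polys_in s \<and> p = (\<Sum>q \<leftarrow> qs. q ^ 2))"

definition quad_form :: "'a :: comm_ring_1 mat \<Rightarrow> 'a vec \<Rightarrow> 'a" where
  "quad_form A v = v \<bullet> (A *\<^sub>v v)"

definition psd_mat :: "nat \<Rightarrow> real mat \<Rightarrow> bool" where
  "psd_mat N A \<longleftrightarrow>
     A \<in> carrier_mat N N \<and> transpose_mat A = A \<and>
     (\<forall>v \<in> carrier_vec N. 0 \<le> quad_form A v)"

definition arrowhead :: "'a :: zero mat \<Rightarrow> bool" where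
  "arrowhead A \<longleftrightarrow>
     (\<forall>i < dim_row A. \<forall>j < dim_col A.
        i \<noteq> 0 \<and> j \<noteq> 0 \<and> i \<noteq> j \<longrightarrow> A $$ (i, j) = 0)"

end

theory Submission
  imports Defs "Jordan_Normal_Form.DL_Rank_Submatrix"
begin

text \<open>
  Write \<open>u\<^sub>2 = (1, w)\<close> and \<open>(u\<^sub>2)\<^sub>0 = (1, w\<^sub>0)\<close>. The form \<open>(w - w\<^sub>0)\<^sup>T (w - w\<^sub>0)\<close> is a quadratic form
  in \<open>(1, w)\<close> whose matrix is an arrowhead matrix with kernel spanned by \<open>(1, w\<^sub>0)\<close>. It vanishes at
  \<open>(u\<^sub>2)\<^sub>0\<close>, so this matrix serves both as \<open>Q\<close> and as \<open>\<Gamma>\<close>. Since the first entry of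
  \<open>u\<^sub>2 - (u\<^sub>2)\<^sub>0\<close> is zero, \<open>E = diag(0, 1, \<dots>, 1)\<close> represents the same form.
\<close>

lemma sum_lookup_keys:
  fixes a :: "nat \<Rightarrow>\<^sub>0 nat"
  assumes "Poly_Mapping.keys a \<subseteq> {..<s}"
  shows "(\<Sum>i\<in>Poly_Mapping.keys a. Poly_Mapping.lookup a i) = (\<Sum>i<s. Poly_Mapping.lookup a i)"
  using assms by (intro sum.mono_neutral_left) (auto simp: in_keys_iff)

text \<open>Stars and bars: a slack entry turns degree at most \<open>d\<close> into sum exactly
  \<open>d\<close>, so exponents correspond to lists of length \<open>s + 1\<close> with prescribed
  sum.\<close>

lemma card_exponents:
  "card {a :: nat \<Rightarrow>\<^sub>0 nat. Poly_Mapping.keys a \<subseteq> {..<s} \<and>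
     (\<Sum>i\<in>Poly_Mapping.keys a. Poly_Mapping.lookup a i) \<le> d} = (s + d) choose d"
  (is "card ?A = _")
proof -
  let ?L = "{l :: nat list. length l = Suc s \<and> sum_list l = d}"
  let ?f = "\<lambda>a. map (Poly_Mapping.lookup a) [0..<s] @ [d - (\<Sum>i<s. Poly_Mapping.lookup a i)]"
  \<comment> \<open>\<open>Poly_Mapping.nth\<close> pads a list with zeros, so dropping the slack
    entry leaves an exponent supported below \<open>s\<close>.\<close>
  let ?g = "\<lambda>l. Poly_Mapping.nth (butlast l)"
  have "bij_betw ?f ?A ?L"
  proof (rule bij_betw_byWitness[where f' = ?g])
    show "\<forall>a\<in>?A. ?g (?f a) = a"
      by (auto intro!: poly_mapping_eqI simp: nth_default_def in_keys_iff not_less)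
    \<comment> \<open>This bounds the sum of the first \<open>s\<close> entries by \<open>d\<close>,
      so the truncated subtraction in \<open>?f\<close> recovers the slack exactly.\<close>
    have split: "sum_list l = (\<Sum>i<s. butlast l ! i) + last l" if "length l = Suc s" for l :: "nat list"
    proof -
      have "l = butlast l @ [last l]"
        using that by (metis append_butlast_last_id length_0_conv nat.distinct(1))
      then have "sum_list l = sum_list (butlast l) + last l"
        by (metis sum_list.append sum_list_simps(2) sum_list.Nil add_0_right)
      then show ?thesis
        using that by (simp add: sum_list_sum_nth atLeast0LessThan)
    qed
    show "\<forall>l\<in>?L. ?f (?g l) = l"
    proof
      fix l assume l: "l \<in> ?L"
      then have "l = butlast l @ [last l]"
        by (metis (mono_tags, lifting) append_butlast_last_id length_0_conv mem_Collect_eq nat.distinct(1))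
      moreover have "map (Poly_Mapping.lookup (?g l)) [0..<s] = butlast l"
        using l by (intro nth_equalityI) (auto simp: nth_default_def nth_butlast)
      moreover have "d - (\<Sum>i<s. Poly_Mapping.lookup (?g l) i) = last l"
        using l split[of l] by (auto simp: nth_default_def nth_butlast)
      ultimately show "?f (?g l) = l" by simp
    qed
    show "?f ` ?A \<subseteq> ?L"
      by (auto simp: sum_lookup_keys interv_sum_list_conv_sum_set_nat atLeast0LessThan)
    show "?g ` ?L \<subseteq> ?A"
    proof
      fix a assume "a \<in> ?g ` ?L"
      then obtain l where l: "l \<in> ?L" "a = ?g l" by blast
      then have "Poly_Mapping.keys a \<subseteq> {..<s}"
        by (auto simp: in_keys_iff nth_default_def simp del: keys_nth split: if_splits)
      moreover have "(\<Sum>i<s. Poly_Mapping.lookup a i) \<le> d"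
        using l split[of l] by (auto simp: nth_default_def nth_butlast)
      ultimately show "a \<in> ?A" by (simp add: sum_lookup_keys)
    qed
  qed
  then have "card ?A = card ?L" by (rule bij_betw_same_card)
  then show ?thesis by (simp add: card_length_sum_list add.commute)
qed

lemma card_monomials: "card (monomials s d) = (s + d) choose d"
proof -
  have "monomials s d = (\<lambda>a. Poly_Mapping.single a 1) `
      {a. Poly_Mapping.keys a \<subseteq> {..<s} \<and> (\<Sum>i\<in>Poly_Mapping.keys a. Poly_Mapping.lookup a i) \<le> d}"
    unfolding monomials_def by auto
  moreover have "inj (\<lambda>a :: nat \<Rightarrow>\<^sub>0 nat. Poly_Mapping.single a (1 :: real))"
    by (intro injI) (metis lookup_single_eq lookup_single_not_eq zero_neq_one)
  ultimately show ?thesis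
    by (simp add: card_image inj_on_subset card_exponents)
qed

text \<open>The bijection with the monomials fixes the length of \<open>u\<close>; for degree 2 it
  is the \<open>N\<close> of the theorem.\<close>

lemma monomial_vec_dim:
  assumes "monomial_vec s d u"
  shows "dim_vec u = (s + d) choose d"
  using assms bij_betw_same_card[of "\<lambda>i. u $ i" "{..<dim_vec u}" "monomials s d"]
  by (simp add: monomial_vec_def card_monomials)

lemma monomials_subset_polys_in: "monomials s d \<subseteq> polys_in s"
  by (auto simp: monomials_def polys_in_def)

lemma pconst_in_polys_in: "pconst c \<in> polys_in s"
  by (simp add: pconst_def polys_in_def)

lemma diff_in_polys_in:
  assumes "p \<in> polys_in s" "q \<in> polys_in s"
  shows "p - q \<in> polys_in s"
  using assms keys_diff[of p q] unfolding polys_in_def by blast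

lemma peval_1: "peval z 1 = 1"
  by (simp add: peval_def)

interpretation pconst: comm_ring_hom pconst
  by standard (simp_all add: pconst_def single_add mult_single)

text \<open>The linear map sending \<open>v\<close> to the vector with entries
  \<open>v $ i - w $ i * v $ 0\<close>, and 0 in front. The ring is left general to cover both real
  and polynomial vectors.\<close>

definition shift_factor :: "nat \<Rightarrow> 'a :: comm_ring_1 vec \<Rightarrow> 'a mat" where
  "shift_factor N w = mat N N (\<lambda>(i, j).
     if i = 0 then 0 else if j = i then 1 else if j = 0 then - w $ i else 0)"

text \<open>A Gram matrix, hence symmetric and, over the reals, positive semidefinite.\<close>

definition shift_mat :: "nat \<Rightarrow> 'a :: comm_ring_1 vec \<Rightarrow> 'a mat" where
  "shift_mat N w = transpose_mat (shift_factor N w) * shift_factor N w"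

lemma shift_factor_carrier [simp]: "shift_factor N w \<in> carrier_mat N N"
  by (simp add: shift_factor_def)

lemma shift_factor_dim [simp]:
  "dim_row (shift_factor N w) = N" "dim_col (shift_factor N w) = N"
  by (simp_all add: shift_factor_def)

lemma shift_mat_carrier [simp]: "shift_mat N w \<in> carrier_mat N N"
  unfolding shift_mat_def by (rule mult_carrier_mat[of _ N N]) simp_all

lemma shift_mat_dim [simp]: "dim_row (shift_mat N w) = N" "dim_col (shift_mat N w) = N"
  by (simp_all add: shift_mat_def)

lemma shift_factor_mult_vec:
  assumes "v \<in> carrier_vec N" "i < N"
  shows "(shift_factor N w *\<^sub>v v) $ i = (if i = 0 then 0 else v $ i - w $ i * v $ 0)"
proof (cases "i = 0")
  case True
  then show ?thesis using assms by (simp add: shift_factor_def scalar_prod_def)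
next
  case False
  have "(shift_factor N w *\<^sub>v v) $ i =
      (\<Sum>j<N. shift_factor N w $$ (i, j) * v $ j)"
    using assms by (simp add: scalar_prod_def atLeast0LessThan)
  \<comment> \<open>As \<open>i\<close> is not 0, the diagonal and column 0 are different places in
    row \<open>i\<close>, and the row sum separates into two one-term sums.\<close>
  also have "\<dots> = (\<Sum>j<N. (if j = i then v $ j else 0) + (if j = 0 then - w $ i * v $ j else 0))"
    using assms False by (intro sum.cong) (auto simp: shift_factor_def)
  also have "\<dots> = v $ i - w $ i * v $ 0"
    using assms by (simp add: sum.distrib)
  finally show ?thesis using False by simp
qed

text \<open>For B = \<open>shift_factor N w\<close>, the form is the scalar product of Bv with
  itself. Over polynomials this already displays a sum of squares.\<close>

lemma quad_form_shift_mat: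
  assumes "v \<in> carrier_vec N"
  shows "quad_form (shift_mat N w) v = (\<Sum>i\<in>{1..<N}. (v $ i - w $ i * v $ 0) ^ 2)"
proof -
  let ?B = "shift_factor N w"
  have Bv: "?B *\<^sub>v v \<in> carrier_vec N" using assms by (rule mult_mat_vec_carrier[OF shift_factor_carrier])
  have "quad_form (shift_mat N w) v = v \<bullet> (transpose_mat ?B *\<^sub>v (?B *\<^sub>v v))"
    using assms by (simp add: quad_form_def shift_mat_def assoc_mult_mat_vec[of _ N N _ N])
  \<comment> \<open>The factors are swapped so that the transpose stands on the left, where the
    adjoint rule can move it across.\<close>
  also have "\<dots> = (transpose_mat ?B *\<^sub>v (?B *\<^sub>v v)) \<bullet> v"
    using assms Bv by (intro comm_scalar_prod[of _ N]) (auto intro!: mult_mat_vec_carrier)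
  also have "\<dots> = (?B *\<^sub>v v) \<bullet> (?B *\<^sub>v v)"
    using assms Bv by (intro transpose_vec_mult_scalar) auto
  also have "\<dots> = (\<Sum>i<N. ((?B *\<^sub>v v) $ i) ^ 2)"
    using Bv by (simp add: scalar_prod_def power2_eq_square atLeast0LessThan)
  also have "\<dots> = (\<Sum>i<N. if i = 0 then 0 else (v $ i - w $ i * v $ 0) ^ 2)"
    using assms by (intro sum.cong) (auto simp: shift_factor_mult_vec simp del: index_mult_mat_vec)
  also have "\<dots> = (\<Sum>i\<in>{1..<N}. (v $ i - w $ i * v $ 0) ^ 2)"
    by (intro sum.mono_neutral_cong_right) auto
  finally show ?thesis .
qed

text \<open>Columns of \<open>shift_factor N w\<close> other than column 0 are distinct unit
  vectors, so their Gram matrix is the identity. Both the arrowhead pattern and the rank bound rest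
  on this.\<close>

lemma shift_mat_index:
  assumes "i < N" "j < N" "i \<noteq> 0" "j \<noteq> 0"
  shows "shift_mat N w $$ (i, j) = (if i = j then 1 else 0)"
proof -
  have "shift_mat N w $$ (i, j) = (\<Sum>k<N. shift_factor N w $$ (k, i) * shift_factor N w $$ (k, j))"
    using assms by (simp add: shift_mat_def scalar_prod_def atLeast0LessThan)
  also have "\<dots> = (\<Sum>k<N. if k = i then (if i = j then 1 else 0) else 0)"
    using assms by (intro sum.cong) (auto simp: shift_factor_def)
  finally have "shift_mat N w $$ (i, j) = (\<Sum>k<N. if k = i then (if i = j then 1 else 0) else 0)" .
  then show ?thesis using assms by simp
qed

lemma arrowhead_shift_mat: "arrowhead (shift_mat N w)"
  by (auto simp: arrowhead_def shift_mat_index)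

lemma psd_shift_mat: "psd_mat N (shift_mat N w)"
proof -
  have "transpose_mat (shift_mat N w) = shift_mat N w"
    by (simp add: shift_mat_def transpose_mult[of _ N N _ N])
  then show ?thesis
    by (simp add: psd_mat_def quad_form_shift_mat sum_nonneg)
qed

text \<open>The factor is built from 0, 1 and negated entries of \<open>w\<close>, all respected by
  a ring homomorphism; the formula for the form thus applies over polynomials.\<close>

lemma map_mat_shift_mat:
  assumes "w \<in> carrier_vec N"
  shows "map_mat pconst (shift_mat N w) = shift_mat N (map_vec pconst w)"
proof -
  have "map_mat pconst (shift_factor N w) = shift_factor N (map_vec pconst w)"
    using assms by (intro eq_matI) (auto simp: shift_factor_def pconst.hom_uminus)
  then show ?thesis
    by (simp add: shift_mat_def pconst.mat_hom_mult[of _ N N _ N] map_mat_transpose[symmetric])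
qed

text \<open>A nonzero kernel vector makes the determinant vanish; deleting row and column 0 leaves
  an identity minor of size \<open>N - 1\<close>.\<close>

lemma rank_shift_mat:
  fixes w :: "real vec"
  assumes "N > 0"
  shows "vec_space.rank N (shift_mat N w) = N - 1"
proof -
  let ?M = "shift_mat N w"
  let ?v = "vec N (\<lambda>i. if i = 0 then 1 else w $ i)"
  \<comment> \<open>Selects every index but 0; an infinite set makes \<open>pick\<close> injective
    on all naturals.\<close>
  let ?J = "{0 :: nat<..}"
  have J: "infinite ?J" by (rule infinite_Ioi)
  have "shift_factor N w *\<^sub>v ?v = 0\<^sub>v N"
    using assms by (intro eq_vecI) (auto simp: shift_factor_mult_vec simp del: index_mult_mat_vec)
  then have "?M *\<^sub>v ?v = 0\<^sub>v N"
    by (simp add: shift_mat_def assoc_mult_mat_vec[of _ N N _ N])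
      (rule eq_vecI, auto simp: shift_factor_def)
  moreover have "?v \<noteq> 0\<^sub>v N"
  proof
    assume "?v = 0\<^sub>v N"
    then have "?v $ 0 = 0\<^sub>v N $ 0" by simp
    then show False using assms by simp
  qed
  ultimately have "det ?M = 0"
    unfolding det_0_iff_vec_prod_zero[OF shift_mat_carrier] by (intro exI[of _ ?v]) simp
  then have "vec_space.rank N ?M < N"
    by (intro vec_space.det_zero_low_rank) simp_all
  moreover have "N - 1 \<le> vec_space.rank N ?M"
  proof -
    have card: "card {i. i < N \<and> i \<in> ?J} = N - 1"
    proof -
      have "{i. i < N \<and> i \<in> ?J} = {1..<N}" by auto
      then show ?thesis by simp
    qed
    have "submatrix ?M ?J ?J = 1\<^sub>m (N - 1)"
    proof (rule eq_matI)
      fix i j assume ij: "i < dim_row (1\<^sub>m (N - 1) :: real mat)" "j < dim_col (1\<^sub>m (N - 1) :: real mat)"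
      have "pick ?J k < N" "pick ?J k \<noteq> 0" if "k < N - 1" for k
        using pick_le[of k N ?J] pick_in_set_inf[OF J, of k] that card by auto
      then show "submatrix ?M ?J ?J $$ (i, j) = 1\<^sub>m (N - 1) $$ (i, j)"
        using ij pick_eq_iff_inf[OF J, of i j]
        by (simp add: submatrix_index card[simplified] shift_mat_index)
    qed (use card in \<open>simp_all add: dim_submatrix\<close>)
    then show ?thesis
      using vec_space.rank_gt_minor[OF shift_mat_carrier[of N w], of ?J ?J] card by simp
  qed
  ultimately show ?thesis by simp
qed

theorem theorem4p2:
  fixes n m s N :: nat and z0 :: "real vec" and u :: "mpoly vec" and u0 :: "real vec"
  assumes "n \<ge> 1" and "m \<ge> 1"
    and "s = n + m - 1"
    and "N = (s + 2) choose 2"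
    and "z0 \<in> carrier_vec s" and "\<forall>i < s. z0 $ i \<noteq> 0"
    and "monomial_vec s 2 u"
    and "u0 = map_vec (peval z0) u"
  shows "\<exists>Q E \<Gamma> :: real mat.
    psd_mat N Q \<and> psd_mat N E \<and> psd_mat N \<Gamma> \<and>
    vec_space.rank N Q = N - 1 \<and> vec_space.rank N E = N - 1 \<and> vec_space.rank N \<Gamma> = N - 1 \<and>
    quad_form (map_mat pconst Q) u - pconst (quad_form Q u0)
      = quad_form (map_mat pconst E) (u - map_vec pconst u0) \<and>
    quad_form (map_mat pconst E) (u - map_vec pconst u0)
      = quad_form (map_mat pconst \<Gamma>) u \<and>
    sum_of_squares s (quad_form (map_mat pconst Q) u - pconst (quad_form Q u0)) \<and>
    arrowhead Q"
proof -
  \<comment> \<open>The choice \<open>w = 0\<close> gives the diagonal matrix, so the same lemmas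
    serve \<open>?E\<close>.\<close>
  let ?Q = "shift_mat N u0" and ?E = "shift_mat N (0\<^sub>v N :: real vec)"
  let ?p = "\<Sum>i\<in>{1..<N}. (u $ i - pconst (u0 $ i)) ^ 2"
  have N: "N > 0" using assms(4) by simp
  have u: "u \<in> carrier_vec N"
    by (rule carrier_vecI) (simp only: monomial_vec_dim[OF assms(7)] assms(4))
  then have u0: "u0 \<in> carrier_vec N" using assms(8) by simp
  have first: "u $ 0 = 1" using assms(7) by (simp add: monomial_vec_def)
  then have first0: "u0 $ 0 = 1" using u N assms(8) by (simp add: peval_1)
  \<comment> \<open>Each square has base \<open>u0 $ i - u0 $ i * 1\<close>, so the subtracted
    constant is 0.\<close>
  have "quad_form ?Q u0 = 0"
    using u0 first0 by (simp add: quad_form_shift_mat)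
  \<comment> \<open>The leading monomial 1 turns each base into
    \<open>u $ i - pconst (u0 $ i)\<close>.\<close>
  moreover have "quad_form (map_mat pconst ?Q) u = ?p"
    using u u0 first by (simp add: map_mat_shift_mat quad_form_shift_mat)
  moreover have "quad_form (map_mat pconst ?E) (u - map_vec pconst u0) = ?p"
    using u u0 by (simp add: map_mat_shift_mat quad_form_shift_mat)
  moreover have "sum_of_squares s ?p"
    unfolding sum_of_squares_def
  proof (intro exI conjI)
    have "u $ i \<in> polys_in s" if "i < N" for i
      using assms(7) that u monomials_subset_polys_in[of s 2]
      by (auto simp: monomial_vec_def bij_betw_def)
    then show "set (map (\<lambda>i. u $ i - pconst (u0 $ i)) [1..<N]) \<subseteq> polys_in s"
      by (auto intro!: diff_in_polys_in pconst_in_polys_in)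
    show "?p = (\<Sum>q\<leftarrow>map (\<lambda>i. u $ i - pconst (u0 $ i)) [1..<N]. q ^ 2)"
      by (simp add: interv_sum_list_conv_sum_set_nat comp_def)
  qed
  ultimately show ?thesis
    using N
    by (intro exI[of _ ?Q] exI[of _ ?E] exI[of _ ?Q])
      (simp add: psd_shift_mat rank_shift_mat arrowhead_shift_mat)
qed

end
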